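(* Let $\theta = x\frac{d}{dx}$ and let $L$ be the differential operator $$L=\theta^{3}-x(2\theta+1)(11\theta^{2}+11\theta+5)+125x^{2}(\theta+1)^{3}.$$ Define $A_0=1$ and, for every integer $n>0$, $$A_{n}=5\binom{2n}{n}^{-1}\binom{3n}{n}^{-1}\sum_{k=0}^{\lfloor n/5\rfloor}(-1)^{k}\,\frac{n-2k}{4n-5k}\binom{n}{k}^{-2}\binom{n}{5k}\binom{5n-5k}{n}^{-1}\frac{(5k)!}{k!^{5}}\,\frac{(5n-5k)!}{(n-k)!^{5}}.$$ Then the formal power series $y=\sum_{n=0}^{\infty}A_{n}x^{n}$ satisfies $Ly=0$.
   Context: The operator $\theta=x\frac{d}{dx}$ acts on formal power series in $x$ by $\theta x^n = n x^n$. In $L$, the powers of $x$ stand to the left of the polynomials in $\theta$, so the polynomial in $\theta$ is applied first and the result is then multiplied by the power of $x$. $\lfloor\cdot\rfloor$ denotes the integer part. *)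

theory Defs
  imports "HOL-Computational_Algebra.Computational_Algebra"
begin

(* The library's fps_XD is x * d/dx.  A polynomial p in this operator acts as
   the sum of p_i * theta^i, where theta^i is the i-fold iterate. *)
definition theta_poly :: "rat poly \<Rightarrow> rat fps \<Rightarrow> rat fps" where
  "theta_poly p f = (\<Sum>i\<le>degree p. fps_const (coeff p i) * (fps_XD ^^ i) f)"

lemma theta_poly_nth: "fps_nth (theta_poly p f) n = poly p (of_nat n) * fps_nth f n"
  by (simp add: theta_poly_def fps_sum_nth fps_mult_fps_XD_shift poly_altdef
      sum_distrib_right mult.assoc)

(* Products of polynomials in theta are compositions of operators. *)
lemma theta_poly_mult: "theta_poly (p * q) f = theta_poly p (theta_poly q f)"
  by (simp add: fps_eq_iff theta_poly_nth mult.assoc)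

(* [:0, 1:] is theta, [:1, 2:] is 2 theta + 1, [:5, 11, 11:] is
   11 theta^2 + 11 theta + 5 and [:1, 1:] is theta + 1. *)
definition L :: "rat fps \<Rightarrow> rat fps" where
  "L f = theta_poly ([:0, 1:] ^ 3) f
       - fps_X * theta_poly ([:1, 2:] * [:5, 11, 11:]) f
       + fps_const 125 * fps_X ^ 2 * theta_poly ([:1, 1:] ^ 3) f"

(* In the range of summation 5 * k \<le> n, so the subtractions of natural numbers
   inside of_nat do not truncate. *)
definition A :: "nat \<Rightarrow> rat" where
  "A n = (if n = 0 then 1 else
     5 * inverse (of_nat ((2 * n) choose n)) * inverse (of_nat ((3 * n) choose n)) *
     (\<Sum>k = 0..n div 5.
        (- 1) ^ k
        * (of_nat (n - 2 * k) / of_nat (4 * n - 5 * k))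
        * inverse (of_nat (n choose k) ^ 2)
        * of_nat (n choose (5 * k))
        * inverse (of_nat ((5 * n - 5 * k) choose n))
        * (fact (5 * k) / fact k ^ 5)
        * (fact (5 * n - 5 * k) / fact (n - k) ^ 5)))"

end

theory Submission
  imports Defs
begin

text \<open>
  After cancellation, \<open>A n\<close> for \<open>n > 0\<close> is the sum over \<open>k\<close> of the hypergeometric term
  \<open>(-1)^k (n choose k)^3 (4n-5k choose 3n) 5(n-2k)/(4n-5k)\<close>. The proof is creative telescoping:
  applied to this term, the recurrence operator that expresses \<open>L y = 0\<close> gives
  \<open>scale n * (p0 - p1 + p2) * base_term n k\<close>, where \<open>base_term\<close> collects the common factorials and
  \<open>base_term n (k+1) / base_term n k = ratio_num n k / ratio_den n k\<close>. Gosper's equation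
  \<open>p0 - p1 + p2 = ratio_num n k * g (k+1) - ratio_den n (k-1) * g k\<close> has a polynomial solution
  \<open>g = gosper n\<close> (found by solving for its coefficients at many \<open>n\<close> and interpolating), so the sum
  telescopes; both boundary terms vanish, because of the factors \<open>k^3\<close> in
  \<open>ratio_den n (k-1)\<close> and \<open>n+2-5k, ..., n-2-5k\<close> in \<open>ratio_num n k\<close>.
\<close>

section \<open>The hypergeometric term and its Gosper certificate\<close>

text \<open>The value 0 for \<open>5 * k > m\<close> lets the sums for three consecutive
  \<open>m\<close> share one range of \<open>k\<close>.\<close>

definition summand :: "nat \<Rightarrow> nat \<Rightarrow> rat" where
  "summand m k = (if 5 * k \<le> m then
     (- 1) ^ k * 5 * (of_nat m - 2 * of_nat k) * fact m ^ 3 * fact (4 * m - 5 * k - 1)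
     / (fact k ^ 3 * fact (m - k) ^ 3 * fact (3 * m) * fact (m - 5 * k)) else 0)"

text \<open>Among the shifts \<open>n\<close>, \<open>n + 1\<close>, \<open>n + 2\<close> of the
  summand, this takes the smallest numerator factorial and the largest denominator ones, so that all
  three quotients are polynomials in \<open>k\<close>.\<close>

definition base_term :: "nat \<Rightarrow> nat \<Rightarrow> rat" where
  "base_term n k = (- 1) ^ k * fact (4 * n - 5 * k - 1)
     / (fact k ^ 3 * fact (n + 2 - k) ^ 3 * fact (n + 2 - 5 * k))"

definition scale :: "nat \<Rightarrow> rat" where
  "scale n = 5 * fact (n + 1) ^ 3 * of_nat (n + 2) / fact (3 * n + 6)"

text \<open>The coefficient is \<open>375 = 125 * 3\<close>: in
  \<open>fact (3 * n + 6) / fact (3 * n)\<close> the top factor is \<open>3 * (n + 2)\<close>, and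
  its \<open>n + 2\<close> cancels against \<open>scale n\<close>. The 3 in \<open>p1\<close> has
  the same origin.\<close>

definition p0 :: "rat \<Rightarrow> rat \<Rightarrow> rat" where
  "p0 n k = 375 * (3 * n + 1) * (3 * n + 2) * (3 * n + 3) * (3 * n + 4) * (3 * n + 5)
     * (n + 1 - k) ^ 3 * (n + 2 - k) ^ 3 * (n + 1 - 5 * k) * (n + 2 - 5 * k) * (n - 2 * k)"

definition p1 :: "rat \<Rightarrow> rat \<Rightarrow> rat" where
  "p1 n k = (2 * n + 3) * (11 * (n + 1) ^ 2 + 11 * (n + 1) + 5) * 3 * (3 * n + 4) * (3 * n + 5)
     * (n + 2 - k) ^ 3 * (n + 2 - 5 * k) * (n + 1 - 2 * k)
     * (4 * n - 5 * k) * (4 * n - 5 * k + 1) * (4 * n - 5 * k + 2) * (4 * n - 5 * k + 3)"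

definition p2 :: "rat \<Rightarrow> rat \<Rightarrow> rat" where
  "p2 n k = (n + 2) ^ 5 * (n + 2 - 2 * k)
     * (4 * n - 5 * k) * (4 * n - 5 * k + 1) * (4 * n - 5 * k + 2) * (4 * n - 5 * k + 3)
     * (4 * n - 5 * k + 4) * (4 * n - 5 * k + 5) * (4 * n - 5 * k + 6) * (4 * n - 5 * k + 7)"

definition ratio_num :: "rat \<Rightarrow> rat \<Rightarrow> rat" where
  "ratio_num n k = - ((n + 2 - k) ^ 3 * (n + 2 - 5 * k) * (n + 1 - 5 * k) * (n - 5 * k)
     * (n - 1 - 5 * k) * (n - 2 - 5 * k))"

definition ratio_den :: "rat \<Rightarrow> rat \<Rightarrow> rat" where
  "ratio_den n k = (k + 1) ^ 3 * (4 * n - 5 * k - 1) * (4 * n - 5 * k - 2) * (4 * n - 5 * k - 3)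
     * (4 * n - 5 * k - 4) * (4 * n - 5 * k - 5)"

definition gosper :: "rat \<Rightarrow> rat \<Rightarrow> rat" where
  "gosper n k =
     - (92640 + 345712 * n + 531600 * n ^ 2 + 431408 * n ^ 3 + 195002 * n ^ 4
        + 46581 * n ^ 5 + 4597 * n ^ 6)
     + (194600 + 608488 * n + 754186 * n ^ 2 + 463144 * n ^ 3 + 140936 * n ^ 4
        + 17006 * n ^ 5) * k
     - (152660 + 387080 * n + 365075 * n ^ 2 + 151770 * n ^ 3 + 23460 * n ^ 4) * k ^ 2
     + (53200 + 103950 * n + 67050 * n ^ 2 + 14300 * n ^ 3) * k ^ 3
     - (7000 + 9625 * n + 3250 * n ^ 2) * k ^ 4"

lemma certificate:
  "p0 n k - p1 n k + p2 n k = ratio_num n k * gosper n (k + 1) - ratio_den n (k - 1) * gosper n k"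
  unfolding p0_def p1_def p2_def ratio_num_def ratio_den_def gosper_def by algebra


section \<open>Reduction of the sum to the cancelled hypergeometric term\<close>

lemma A_eq_sum_summand:
  assumes "m > 0" "m \<le> K * 5 + 4"
  shows "A m = (\<Sum>k\<le>K. summand m k)"
proof -
  have summand_eq: "5 * inverse (of_nat ((2 * m) choose m)) * inverse (of_nat ((3 * m) choose m)) *
      ((- 1) ^ k
        * (of_nat (m - 2 * k) / of_nat (4 * m - 5 * k))
        * inverse (of_nat (m choose k) ^ 2)
        * of_nat (m choose (5 * k))
        * inverse (of_nat ((5 * m - 5 * k) choose m))
        * (fact (5 * k) / fact k ^ 5)
        * (fact (5 * m - 5 * k) / fact (m - k) ^ 5)) = summand m k" (is "?l = _")
    if "5 * k \<le> m" for k
  proof -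
    \<comment> \<open>Since \<open>5 * k \<le> m\<close> and \<open>m > 0\<close>,
      \<open>4 * m - 5 * k\<close> is a successor; dividing by it turns \<open>fact (Suc q)\<close>
      into \<open>fact q\<close>.\<close>
    define q where "q = 4 * m - 5 * k - 1"
    have q: "4 * m - 5 * k = Suc q" "4 * m - Suc (5 * k) = q"
      using that assms by (auto simp: q_def)
    have diffs: "2 * m - m = m" "3 * m - m = 2 * m" "5 * m - 5 * k - m = 4 * m - 5 * k" by auto
    have binom:
      "(of_nat ((2 * m) choose m) :: rat) = fact (2 * m) / (fact m * fact m)"
      "(of_nat ((3 * m) choose m) :: rat) = fact (3 * m) / (fact m * fact (2 * m))"
      "(of_nat (m choose k) :: rat) = fact m / (fact k * fact (m - k))"
      "(of_nat (m choose (5 * k)) :: rat) = fact m / (fact (5 * k) * fact (m - 5 * k))"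
      "(of_nat ((5 * m - 5 * k) choose m) :: rat)
         = fact (5 * m - 5 * k) / (fact m * fact (4 * m - 5 * k))"
      using that by (simp_all add: binomial_fact diffs)
    have "(of_nat (m - 2 * k) :: rat) = of_nat m - 2 * of_nat k"
      using that by (simp add: of_nat_diff)
    moreover have "(fact (Suc q) :: rat) = of_nat (Suc q) * fact q" by (rule fact_Suc)
    moreover have "(of_nat (Suc q) :: rat) \<noteq> 0" by (rule of_nat_neq_0)
    ultimately show ?thesis
      unfolding binom q summand_def
      using that by (simp add: q field_simps power2_eq_square eval_nat_numeral del: fact_Suc of_nat_Suc)
  qed
  have "A m = (\<Sum>k = 0..m div 5. summand m k)"
    unfolding A_def sum_distrib_left using assms
    by (subst if_not_P, simp, intro sum.cong refl summand_eq, auto)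
  also have "\<dots> = (\<Sum>k\<le>K. summand m k)"
    using assms by (intro sum.mono_neutral_left) (auto simp: summand_def)
  finally show ?thesis .
qed

section \<open>Common factorials of the three shifts\<close>

lemma summand_eq_base_term:
  fixes n k :: nat
  assumes "n > 0" "5 * k \<le> n + 2"
  defines "N \<equiv> of_nat n :: rat" and "x \<equiv> of_nat k :: rat"
  shows "125 * (N + 1) ^ 3 * summand n k = scale n * p0 N x * base_term n k"
    and "(2 * N + 3) * (11 * (N + 1) ^ 2 + 11 * (N + 1) + 5) * summand (n + 1) k
           = scale n * p1 N x * base_term n k"
    and "(N + 2) ^ 3 * summand (n + 2) k = scale n * p2 N x * base_term n k"
proof -
  define q where "q = 4 * n - 5 * k - 1"
  \<comment> \<open>\<open>5 * k + 1 \<le> n + 3 \<le> 4 * n\<close> because \<open>n > 0\<close>;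
    for \<open>n = 0\<close> the subtraction in \<open>base_term\<close> would truncate.\<close>
  have "4 * n \<ge> 5 * k + 1" using assms by linarith
  then have q: "(of_nat q :: rat) = 4 * N - 5 * x - 1"
    by (simp add: q_def N_def x_def of_nat_diff)
  have k: "k \<le> n" using assms by linarith
  have q_ix: "4 * n - 5 * k - 1 = q" "4 * (n + 1) - 5 * k - 1 = q + 4"
      "4 * (n + 2) - 5 * k - 1 = q + 8"
    using assms by (auto simp: q_def)
  have fact_4: "fact (i + 4) = (of_nat i + 1) * (of_nat i + 2) * (of_nat i + 3) * (of_nat i + 4)
      * (fact i :: rat)" for i :: nat
    by (simp add: eval_nat_numeral algebra_simps)
  have q4: "fact (q + 4) = ((4 * N - 5 * x) * (4 * N - 5 * x + 1) * (4 * N - 5 * x + 2)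
      * (4 * N - 5 * x + 3)) * (fact q :: rat)"
    unfolding fact_4 q by algebra
  have q8: "fact (q + 8) = ((4 * N - 5 * x) * (4 * N - 5 * x + 1) * (4 * N - 5 * x + 2)
      * (4 * N - 5 * x + 3) * (4 * N - 5 * x + 4) * (4 * N - 5 * x + 5) * (4 * N - 5 * x + 6)
      * (4 * N - 5 * x + 7)) * (fact q :: rat)"
  proof -
    have "fact (q + 8) = (fact (q + 4 + 4) :: rat)" by (simp add: add.assoc)
    also have "\<dots> = (4 * N - 5 * x + 4) * (4 * N - 5 * x + 5) * (4 * N - 5 * x + 6)
        * (4 * N - 5 * x + 7) * fact (q + 4)"
      unfolding fact_4[of "q + 4"] of_nat_add of_nat_numeral q by algebra
    finally show ?thesis unfolding q4 by (simp only: mult_ac)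
  qed
  have n1: "fact (n + 1) = (N + 1) * (fact n :: rat)"
   and n2: "fact (n + 2) = (N + 2) * (fact (n + 1) :: rat)"
   and n3: "fact (3 * n + 6) = 3 * (N + 2) * (3 * N + 5) * (3 * N + 4) * (fact (3 * (n + 1)) :: rat)"
   and n4: "fact (3 * (n + 1)) = (3 * N + 3) * (3 * N + 2) * (3 * N + 1) * (fact (3 * n) :: rat)"
    by (simp_all add: N_def eval_nat_numeral) (simp_all add: algebra_simps)
  have "n + 2 - k = Suc (n + 1 - k)" "n + 1 - k = Suc (n - k)" using k by auto
  then have nk: "fact (n + 2 - k) = (N + 2 - x) * (fact (n + 1 - k) :: rat)"
      "fact (n + 1 - k) = (N + 1 - x) * (fact (n - k) :: rat)"
    using k by (simp_all add: of_nat_diff N_def x_def)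
  have n5k1: "fact (n + 2 - 5 * k) = (N + 2 - 5 * x) * (fact (n + 1 - 5 * k) :: rat)"
      "N + 2 - 5 * x \<noteq> 0" if "5 * k \<le> n + 1"
  proof -
    have *: "n + 2 - 5 * k = Suc (n + 1 - 5 * k)" using that by auto
    have **: "of_nat (Suc (n + 1 - 5 * k)) = N + 2 - 5 * x"
      using that by (simp add: of_nat_diff N_def x_def)
    show "fact (n + 2 - 5 * k) = (N + 2 - 5 * x) * (fact (n + 1 - 5 * k) :: rat)"
      unfolding * fact_Suc ** ..
    show "N + 2 - 5 * x \<noteq> 0" unfolding **[symmetric] by (rule of_nat_neq_0)
  qed
  have n5k2: "fact (n + 1 - 5 * k) = (N + 1 - 5 * x) * (fact (n - 5 * k) :: rat)"
      "N + 1 - 5 * x \<noteq> 0" if "5 * k \<le> n"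
  proof -
    have *: "n + 1 - 5 * k = Suc (n - 5 * k)" using that by auto
    have **: "of_nat (Suc (n - 5 * k)) = N + 1 - 5 * x"
      using that by (simp add: of_nat_diff N_def x_def)
    show "fact (n + 1 - 5 * k) = (N + 1 - 5 * x) * (fact (n - 5 * k) :: rat)"
      unfolding * fact_Suc ** ..
    show "N + 1 - 5 * x \<noteq> 0" unfolding **[symmetric] by (rule of_nat_neq_0)
  qed
  have "x \<le> N" "N \<ge> 0" using k by (simp_all add: N_def x_def)
  then have nz: "N + 2 - x \<noteq> 0" "N + 1 - x \<noteq> 0" "N + 1 \<noteq> 0" "N + 2 \<noteq> 0" "3 * N + 1 \<noteq> 0"
      "3 * N + 2 \<noteq> 0" "3 * N + 3 \<noteq> 0" "3 * N + 4 \<noteq> 0" "3 * N + 5 \<noteq> 0"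
    by linarith+
  have cast: "of_nat n = N" "of_nat (n + 1) = N + 1" "of_nat (n + 2) = N + 2" "of_nat k = x"
    by (simp_all add: N_def x_def)

  show "125 * (N + 1) ^ 3 * summand n k = scale n * p0 N x * base_term n k"
  proof (cases "5 * k \<le> n")
    case True
    \<comment> \<open>The claim with factorials and linear factors as free variables, so that
      simplification sees only a rational identity; the nonzero hypotheses are the cancelled
      factors.\<close>
    have gen: "125 * g1 ^ 3 * (s * 5 * e * u ^ 3 * f / (v ^ 3 * w ^ 3 * z * r))
        = 5 * (g1 * u) ^ 3 * g2 / (3 * g2 * c5 * c4 * (c3 * c2 * c1 * z))
          * (375 * c1 * c2 * c3 * c4 * c5 * d1 ^ 3 * d2 ^ 3 * l1 * l2 * e)
          * (s * f / (v ^ 3 * (d2 * (d1 * w)) ^ 3 * (l2 * (l1 * r))))"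
      if "g2 \<noteq> 0" "c5 \<noteq> 0" "c4 \<noteq> 0" "c3 \<noteq> 0" "c2 \<noteq> 0" "c1 \<noteq> 0" "d1 \<noteq> 0" "d2 \<noteq> 0" "l1 \<noteq> 0" "l2 \<noteq> 0"
      for g1 g2 s e u f v w z r c1 c2 c3 c4 c5 d1 d2 l1 l2 :: rat
      using that by (simp add: field_simps)
    have le: "5 * k \<le> n + 1" using True by simp
    show ?thesis
      unfolding summand_def scale_def base_term_def p0_def if_P[OF True] q_ix
        n3 n4 n1 nk n5k1(1)[OF le] n5k2(1)[OF True] cast
      by (rule gen) (use nz n5k1(2)[OF le] n5k2(2)[OF True] in auto)
  next
    case False
    \<comment> \<open>At these boundary values the summand is 0 by its default, matched by a zero of
      one of the linear factors of \<open>p0\<close>.\<close>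
    then have "n + 1 = 5 * k \<or> n + 2 = 5 * k" using assms by linarith
    then have "of_nat (n + 1) = (of_nat (5 * k) :: rat) \<or> of_nat (n + 2) = (of_nat (5 * k) :: rat)"
      by metis
    then have "N + 1 - 5 * x = 0 \<or> N + 2 - 5 * x = 0"
      by (simp add: N_def x_def add.commute)
    then have "p0 N x = 0" unfolding p0_def by auto
    then show ?thesis using False by (simp add: summand_def)
  qed

  show "(2 * N + 3) * (11 * (N + 1) ^ 2 + 11 * (N + 1) + 5) * summand (n + 1) k
      = scale n * p1 N x * base_term n k"
  proof (cases "5 * k \<le> n + 1")
    case True
    have gen: "g1 * g2 * (s * 5 * e * u ^ 3 * (F1 * F2 * F3 * F4 * f) / (v ^ 3 * w ^ 3 * z * r))
        = 5 * u ^ 3 * g / (3 * g * c5 * c4 * z)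
          * (g1 * g2 * 3 * c4 * c5 * d ^ 3 * l * e * F1 * F2 * F3 * F4)
          * (s * f / (v ^ 3 * (d * w) ^ 3 * (l * r)))"
      if "g \<noteq> 0" "c5 \<noteq> 0" "c4 \<noteq> 0" "d \<noteq> 0" "l \<noteq> 0"
      for g g1 g2 s e u f v w z r c4 c5 d l F1 F2 F3 F4 :: rat
      using that by (simp add: field_simps)
    show ?thesis
      unfolding summand_def scale_def base_term_def p1_def if_P[OF True] q_ix q4
        n3 nk(1) n5k1(1)[OF True] cast
      by (rule gen) (use nz n5k1(2)[OF True] in auto)
  next
    case False
    then have "n + 2 = 5 * k" using assms by linarith
    then have "of_nat (n + 2) = (of_nat (5 * k) :: rat)" by metis
    then have "N + 2 - 5 * x = 0" by (simp add: N_def x_def)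
    then have "p1 N x = 0" unfolding p1_def by auto
    then show ?thesis using False by (simp add: summand_def)
  qed

  \<comment> \<open>\<open>scale\<close> and \<open>base_term\<close> have exactly the denominators
    of the summand at \<open>n + 2\<close>, so nothing has to be cancelled.\<close>
  have gen: "g ^ 3 * (s * 5 * e * (g * u) ^ 3 * (F1 * F2 * F3 * F4 * F5 * F6 * F7 * F8 * f)
        / (v ^ 3 * w ^ 3 * z * r))
      = 5 * u ^ 3 * g / z
        * (g ^ 5 * e * F1 * F2 * F3 * F4 * F5 * F6 * F7 * F8)
        * (s * f / (v ^ 3 * w ^ 3 * r))"
    for g s e u f v w z r F1 F2 F3 F4 F5 F6 F7 F8 :: rat
    by (simp add: power_mult_distrib mult_ac flip: power_add)
       (simp add: eval_nat_numeral mult_ac)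
  have "3 * (n + 2) = 3 * n + 6" by simp
  then show "(N + 2) ^ 3 * summand (n + 2) k = scale n * p2 N x * base_term n k"
    unfolding summand_def scale_def base_term_def p2_def if_P[OF assms(2)] q_ix q8 n2 cast
    by (simp only: gen)
qed

section \<open>Telescoping\<close>

lemma base_term_Suc:
  assumes "5 * Suc k \<le> n + 2"
  shows "ratio_num (of_nat n) (of_nat k) * base_term n k
           = ratio_den (of_nat n) (of_nat k) * base_term n (Suc k)"
proof -
  define r where "r = n - 3 - 5 * k"
  define m where "m = n + 1 - k"
  define x :: rat where "x = of_nat k"
  have n: "n = r + 5 * k + 3" and m: "n + 2 - k = Suc m" "n + 2 - Suc k = m"
    using assms by (auto simp: r_def m_def)
  define q where "q = 4 * n - 5 * Suc k - 1"
  define N :: rat where "N = of_nat n"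
  have ix: "n + 2 - 5 * k = r + 5" "n + 2 - 5 * Suc k = r"
      "4 * n - 5 * k - 1 = q + 5" "4 * n - 5 * Suc k - 1 = q"
    using assms by (auto simp: q_def r_def)
  have r: "(of_nat r :: rat) = N - 3 - 5 * x" by (simp add: n N_def x_def)
  have q: "(of_nat q :: rat) = 4 * N - 5 * x - 6"
    using assms by (simp add: q_def N_def x_def of_nat_diff)
  have M: "(of_nat m :: rat) = N + 1 - x"
    using n by (simp add: m_def N_def x_def of_nat_diff)
  have fact_5: "fact (i + 5) = (of_nat i + 1) * (of_nat i + 2) * (of_nat i + 3) * (of_nat i + 4)
      * (of_nat i + 5) * (fact i :: rat)" for i :: nat
    by (simp add: eval_nat_numeral algebra_simps)
  have q5: "fact (q + 5) = (4 * N - 5 * x - 1) * (4 * N - 5 * x - 2) * (4 * N - 5 * x - 3)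
      * (4 * N - 5 * x - 4) * (4 * N - 5 * x - 5) * (fact q :: rat)"
    unfolding fact_5 q by algebra
  have r5: "fact (r + 5) = (N + 2 - 5 * x) * (N + 1 - 5 * x) * (N - 5 * x)
      * (N - 1 - 5 * x) * (N - 2 - 5 * x) * (fact r :: rat)"
    unfolding fact_5 r by algebra
  have m1: "fact (Suc m) = (N + 2 - x) * (fact m :: rat)" by (simp add: M)
  have k1: "fact (Suc k) = (x + 1) * (fact k :: rat)" by (simp add: x_def)
  have s1: "(- 1) ^ Suc k = - ((- 1) ^ k :: rat)" by simp
  have "of_nat (Suc m) \<noteq> (0 :: rat)" "of_nat (Suc k) \<noteq> (0 :: rat)" by (rule of_nat_neq_0)+
  then have nz: "N + 2 - x \<noteq> 0" "x + 1 \<noteq> 0" by (simp_all add: M x_def)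
  \<comment> \<open>The five factors make up \<open>fact (r + 5) / fact r\<close>, so all are
    nonzero at once.\<close>
  have "(fact (r + 5) :: rat) \<noteq> 0" by (rule fact_nonzero)
  then have nz5: "N + 2 - 5 * x \<noteq> 0" "N + 1 - 5 * x \<noteq> 0" "N - 5 * x \<noteq> 0"
      "N - 1 - 5 * x \<noteq> 0" "N - 2 - 5 * x \<noteq> 0"
    unfolding r5 by auto
  have gen: "- (d ^ 3 * l1 * l2 * l3 * l4 * l5)
        * (s * (F1 * F2 * F3 * F4 * F5 * f) / (v ^ 3 * (d * w) ^ 3 * (l1 * l2 * l3 * l4 * l5 * z)))
      = (c ^ 3 * F1 * F2 * F3 * F4 * F5) * (- s * f / ((c * v) ^ 3 * w ^ 3 * z))"
    if "d \<noteq> 0" "c \<noteq> 0" "l1 \<noteq> 0" "l2 \<noteq> 0" "l3 \<noteq> 0" "l4 \<noteq> 0" "l5 \<noteq> 0"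
    for d l1 l2 l3 l4 l5 s F1 F2 F3 F4 F5 f v w z c :: rat
    using that by (simp add: field_simps)
  show ?thesis
    unfolding ratio_num_def ratio_den_def base_term_def ix m q5 r5 m1 k1 s1
      x_def[symmetric] N_def[symmetric]
    by (rule gen) (fact nz nz5)+
qed

text \<open>By \<open>base_term_Suc\<close>, the negative part of the certificate at
  \<open>k + 1\<close> cancels the positive part at \<open>k\<close>, leaving only the upper
  boundary term.\<close>

lemma sum_telescope:
  assumes "5 * K \<le> n + 2"
  shows "(\<Sum>k\<le>K. (p0 (of_nat n) (of_nat k) - p1 (of_nat n) (of_nat k) + p2 (of_nat n) (of_nat k))
             * base_term n k)
           = ratio_num (of_nat n) (of_nat K) * gosper (of_nat n) (of_nat K + 1) * base_term n K"
  using assms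
proof (induction K)
  case 0
  \<comment> \<open>The argument \<open>k - 1\<close> is rational, hence really -1, and the cube in
    \<open>ratio_den\<close> vanishes.\<close>
  then show ?case by (simp add: certificate ratio_den_def)
next
  case (Suc K)
  have gen: "u * g * v + (c - w * g) * v' = c * v'" if "u * v = w * v'" for u g v c w v' :: rat
    using that by algebra
  have cast: "of_nat (Suc K) - 1 = (of_nat K :: rat)" "of_nat (Suc K) = (of_nat K :: rat) + 1"
    by simp_all
  have "(\<Sum>k\<le>Suc K. (p0 (of_nat n) (of_nat k) - p1 (of_nat n) (of_nat k)
             + p2 (of_nat n) (of_nat k)) * base_term n k)
      = ratio_num (of_nat n) (of_nat K) * gosper (of_nat n) (of_nat K + 1) * base_term n K
        + (p0 (of_nat n) (of_nat (Suc K)) - p1 (of_nat n) (of_nat (Suc K))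
             + p2 (of_nat n) (of_nat (Suc K))) * base_term n (Suc K)"
    using Suc by (simp del: of_nat_Suc)
  also have "\<dots> = ratio_num (of_nat n) (of_nat (Suc K)) * gosper (of_nat n) (of_nat (Suc K) + 1)
      * base_term n (Suc K)"
    \<comment> \<open>The shifted argument must collapse to \<open>of_nat K\<close> before
      \<open>cast(2)\<close> rewrites the remaining successors.\<close>
    unfolding certificate cast(1)
    unfolding cast(2)
    by (rule gen[OF base_term_Suc[OF Suc.prems]])
  finally show ?case .
qed

section \<open>From the recurrence to the differential equation\<close>

text \<open>The left-hand side is the coefficient of \<open>x^(n+2)\<close> in
  \<open>L y\<close>.\<close>

lemma A_recurrence:
  "(of_nat n + 2) ^ 3 * A (n + 2)
     - (2 * of_nat n + 3) * (11 * (of_nat n + 1) ^ 2 + 11 * (of_nat n + 1) + 5) * A (n + 1)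
     + 125 * (of_nat n + 1) ^ 3 * A n = 0"
proof (cases "n = 0")
  case True
  \<comment> \<open>\<open>A 0\<close> is set by convention rather than by the sum, so this case is
    numerical: \<open>8 * 35 - 81 * 5 + 125 = 0\<close>.\<close>
  have "A 1 = 5" "A 2 = 35"
    by (simp_all add: A_eq_sum_summand[of _ 0] summand_def fact_numeral)
  then show ?thesis using True by (simp add: A_def numeral_2_eq_2)
next
  case False
  define K where "K = (n + 2) div 5"
  define N :: rat where "N = of_nat n"
  have K: "n + 2 \<le> K * 5 + 4" "5 * K \<le> n + 2" by (auto simp: K_def)
  have As: "A n = (\<Sum>k\<le>K. summand n k)" "A (n + 1) = (\<Sum>k\<le>K. summand (n + 1) k)"
      "A (n + 2) = (\<Sum>k\<le>K. summand (n + 2) k)"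
    by (rule A_eq_sum_summand; use False K in linarith)+
  have "(N + 2) ^ 3 * A (n + 2)
     - (2 * N + 3) * (11 * (N + 1) ^ 2 + 11 * (N + 1) + 5) * A (n + 1)
     + 125 * (N + 1) ^ 3 * A n
     = (\<Sum>k\<le>K. (N + 2) ^ 3 * summand (n + 2) k
         - (2 * N + 3) * (11 * (N + 1) ^ 2 + 11 * (N + 1) + 5) * summand (n + 1) k
         + 125 * (N + 1) ^ 3 * summand n k)"
    unfolding As by (simp only: sum_distrib_left sum.distrib sum_subtractf)
  also have "\<dots> = (\<Sum>k\<le>K. scale n
         * ((p0 N (of_nat k) - p1 N (of_nat k) + p2 N (of_nat k)) * base_term n k))"
  proof (intro sum.cong refl)
    fix k assume "k \<in> {..K}"
    then have "n > 0" "5 * k \<le> n + 2" using False K by simp_all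
    note eqs = summand_eq_base_term[OF this, folded N_def]
    show "(N + 2) ^ 3 * summand (n + 2) k
         - (2 * N + 3) * (11 * (N + 1) ^ 2 + 11 * (N + 1) + 5) * summand (n + 1) k
         + 125 * (N + 1) ^ 3 * summand n k
       = scale n * ((p0 N (of_nat k) - p1 N (of_nat k) + p2 N (of_nat k)) * base_term n k)"
      unfolding eqs by (simp add: algebra_simps)
  qed
  also have "\<dots> = scale n * (ratio_num N (of_nat K) * gosper N (of_nat K + 1) * base_term n K)"
    using sum_telescope[OF K(2)] by (simp add: sum_distrib_left[symmetric] N_def)
  also have "ratio_num N (of_nat K) = 0"
  proof -
    \<comment> \<open>The cases are the five remainders of \<open>n + 2\<close> modulo 5; each kills
      one linear factor of \<open>ratio_num\<close>.\<close>
    consider "n + 2 = 5 * K" | "n + 1 = 5 * K" | "n = 5 * K" | "n = 5 * K + 1" | "n = 5 * K + 2"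
      using K by linarith
    then show ?thesis
    proof cases
      case 1
      then have "of_nat n + 2 = 5 * (of_nat K :: rat)"
        by (metis of_nat_add of_nat_mult of_nat_numeral)
      then show ?thesis by (simp add: ratio_num_def N_def)
    next
      case 2
      then have "of_nat n + 1 = 5 * (of_nat K :: rat)"
        by (metis of_nat_add of_nat_mult of_nat_numeral of_nat_1)
      then show ?thesis by (simp add: ratio_num_def N_def)
    qed (simp_all add: ratio_num_def N_def)
  qed
  finally show ?thesis by (simp add: N_def)
qed

theorem mainTheorem1:
  shows "L (Abs_fps A) = 0"
proof (rule fps_ext)
  fix m :: nat
  \<comment> \<open>The recurrence starts at \<open>x^2\<close>; the two lower coefficients are
    \<open>0 * A 0\<close> and \<open>A 1 - 5 * A 0\<close>.\<close>
  consider "m = 0" | "m = 1" | n where "m = n + 2"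
    by (metis One_nat_def add_2_eq_Suc' not0_implies_Suc)
  then show "L (Abs_fps A) $ m = 0 $ m"
  proof cases
    case 1
    then show ?thesis by (simp add: L_def theta_poly_nth mult.assoc power2_eq_square)
  next
    case 2
    have "A 1 = 5" by (simp add: A_eq_sum_summand[of _ 0] summand_def fact_numeral)
    then show ?thesis using 2
      by (simp add: L_def theta_poly_nth mult.assoc power2_eq_square A_def)
  next
    case 3
    then show ?thesis using A_recurrence[of n]
      by (simp add: L_def theta_poly_nth mult.assoc power2_eq_square power3_eq_cube algebra_simps)
  qed
qed

end
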